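(* Let $g$ lie in $\mathcal{C}^0\cap\mathcal{D}^0\cap\mathcal{K}^0$. The following assertions hold. (a) $\gamma[g]=\sigma[g]$. (b) For any $x>0$ we have $$\Sigma g(x)=\sigma[g]-g(x)-\sum_{k=1}^{\infty}\left(g(x+k)-\int_k^{k+1}g(t)\,dt\right)$$ and the series converges uniformly on any bounded subset of $[0,\infty)$. (c) The function $\Sigma g$ lies in $\mathcal{C}^0$ and the series above can be (repeatedly) integrated term by term on any bounded interval of $[0,\infty)$. (d) If $g$ lies in $\mathcal{C}^r\cap\mathcal{K}^r$ for some $r\in\mathbb{N}$, then $\Sigma g$ lies in $\mathcal{C}^r$ and the series above can be differentiated term by term up to $r$ times.
   Context: $\mathbb{N}=\{0,1,2,\ldots\}$, $\mathbb{R}_+=(0,\infty)$, $\Delta f(x)=f(x+1)-f(x)$; $\mathcal{C}^r$ is the set of $r$ times continuously differentiable functions $\mathbb{R}_+\to\mathbb{R}$. For an integer $p\ge -1$, a function $f\colon I\to\mathbb{R}$ on a real interval $I$ is $p$-convex (resp. $p$-concave) if for all $x_0<\cdots<x_{p+1}$ in $I$ the divided difference $f[x_0,\ldots,x_{p+1}]$ is $\ge 0$ (resp. $\le 0$), where $f[x_0,\ldots,x_n]=\sum_{k=0}^n f(x_k)/\prod_{j\ne k}(x_k-x_j)$ ($0$-convex means increasing in the wide sense). $\mathcal{K}^p$ is the set of functions $\mathbb{R}_+\to\mathbb{R}$ that are $p$-convex on some $[a,\infty)$ or $p$-concave on some $[a,\infty)$. $\mathcal{D}^p$ is the set of $g\colon\mathbb{R}_+\to\mathbb{R}$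 with $\Delta^pg(n)\to 0$ as $n\to\infty$ over the integers. For $g\in\mathcal{D}^p\cap\mathcal{K}^p$, the function $\Sigma g\colon\mathbb{R}_+\to\mathbb{R}$ is $$\Sigma g(x)=\lim_{n\to\infty}\Big(-g(x)+\sum_{k=1}^{n-1}(g(k)-g(x+k))+\sum_{j=1}^p\binom{x}{j}\Delta^{j-1}g(n)\Big);$$ the limit exists, does not depend on the choice of such $p$, and $\Sigma g$ is the unique solution $f\in\mathcal{K}^p$ of $\Delta f=g$ with $f(1)=0$; it is continuous if $g$ is. Asymptotic constant: $\sigma[g]=\int_0^1\Sigma g(t+1)\,dt$. Asymptotic degree: $\deg g=-1+\min\{q\in\mathbb{N}:\Delta^qg(x)\to0\text{ as }x\to\infty\}$ (real $x$). With $G_n=\int_0^1\binom{t}{n}dt$ and $J^q[f](x)=\sum_{j=0}^{q-1}G_j\Delta^jf(x)-\int_x^{x+1}f(t)\,dt$, the generalized Euler constant is $\gamma[g]=-J^{p+1}[\Sigma g](1)$ with $p=1+\deg g$ (here $p=0$). *)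

theory Defs
  imports "HOL-Analysis.Analysis"
begin

text \<open>Functions from the positive reals to the reals are represented by total functions
  on \<open>real\<close>; only their values at positive arguments matter.\<close>

definition fdiff :: "(real \<Rightarrow> real) \<Rightarrow> real \<Rightarrow> real" where
  "fdiff f = (\<lambda>x. f (x + 1) - f x)"

definition C_class :: "nat \<Rightarrow> (real \<Rightarrow> real) set" where
  "C_class r = {f. (\<forall>j<r. \<forall>x>0. (deriv ^^ j) f differentiable (at x))
                 \<and> (\<forall>j\<le>r. continuous_on {0<..} ((deriv ^^ j) f))}"

definition divided_diff :: "(real \<Rightarrow> real) \<Rightarrow> nat \<Rightarrow> (nat \<Rightarrow> real) \<Rightarrow> real" where
  "divided_diff f n x = (\<Sum>k\<le>n. f (x k) / (\<Prod>j\<in>{..n} - {k}. x k - x j))"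

definition p_convex_on :: "nat \<Rightarrow> real set \<Rightarrow> (real \<Rightarrow> real) \<Rightarrow> bool" where
  "p_convex_on p I f \<longleftrightarrow>
     (\<forall>x. strict_mono_on {..p + 1} x \<and> x ` {..p + 1} \<subseteq> I \<longrightarrow> 0 \<le> divided_diff f (p + 1) x)"

definition p_concave_on :: "nat \<Rightarrow> real set \<Rightarrow> (real \<Rightarrow> real) \<Rightarrow> bool" where
  "p_concave_on p I f \<longleftrightarrow>
     (\<forall>x. strict_mono_on {..p + 1} x \<and> x ` {..p + 1} \<subseteq> I \<longrightarrow> divided_diff f (p + 1) x \<le> 0)"

definition K_class :: "nat \<Rightarrow> (real \<Rightarrow> real) set" where
  "K_class p = {f. \<exists>a>0. p_convex_on p {a..} f \<or> p_concave_on p {a..} f}"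

definition D_class :: "nat \<Rightarrow> (real \<Rightarrow> real) set" where
  "D_class p = {g. (\<lambda>n::nat. (fdiff ^^ p) g (real n)) \<longlonglongrightarrow> 0}"

definition Sigma_approx :: "nat \<Rightarrow> (real \<Rightarrow> real) \<Rightarrow> nat \<Rightarrow> real \<Rightarrow> real" where
  "Sigma_approx p g n x =
     - g x + (\<Sum>k=1..<n. g (real k) - g (x + real k))
     + (\<Sum>j=1..p. (x gchoose j) * (fdiff ^^ (j - 1)) g (real n))"

text \<open>The limit does not depend on the choice of \<open>p\<close> with \<open>g \<in> D_class p \<inter> K_class p\<close>;
  the least such \<open>p\<close> is taken.\<close>

definition principal_sum :: "(real \<Rightarrow> real) \<Rightarrow> real \<Rightarrow> real" where
  "principal_sum g x =
     lim (\<lambda>n. Sigma_approx (LEAST p. g \<in> D_class p \<inter> K_class p) g n x)"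

definition asymptotic_const :: "(real \<Rightarrow> real) \<Rightarrow> real" where
  "asymptotic_const g = integral {0..1} (\<lambda>t. principal_sum g (t + 1))"

definition asymptotic_deg :: "(real \<Rightarrow> real) \<Rightarrow> int" where
  "asymptotic_deg g = - 1 + int (LEAST q. ((fdiff ^^ q) g \<longlongrightarrow> 0) at_top)"

definition gregory_coeff :: "nat \<Rightarrow> real" where
  "gregory_coeff n = integral {0..1} (\<lambda>t. t gchoose n)"

definition J_op :: "nat \<Rightarrow> (real \<Rightarrow> real) \<Rightarrow> real \<Rightarrow> real" where
  "J_op q f x = (\<Sum>j<q. gregory_coeff j * (fdiff ^^ j) f x) - integral {x..x + 1} f"

definition gen_euler_const :: "(real \<Rightarrow> real) \<Rightarrow> real" where
  "gen_euler_const g = - J_op (nat (1 + asymptotic_deg g) + 1) (principal_sum g) 1"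

definition euler_term :: "(real \<Rightarrow> real) \<Rightarrow> nat \<Rightarrow> real \<Rightarrow> real" where
  "euler_term g k x = g (x + real k) - integral {real k..real k + 1} g"

text \<open>The series over \<open>k \<ge> 1\<close>.  For \<open>x > - 1\<close> it evaluates \<open>g\<close> at positive arguments only,
  so its two-sided derivatives at \<open>x = 0\<close> are meaningful.\<close>

definition euler_series :: "(real \<Rightarrow> real) \<Rightarrow> real \<Rightarrow> real" where
  "euler_series g x = (\<Sum>k. euler_term g (Suc k) x)"

text \<open>Repeated integration, the base point of the \<open>(i+1)\<close>-st integration being \<open>a i\<close>; the
  integrals are oriented, so \<open>x < a i\<close> is allowed.\<close>

primrec iter_integral ::
    "(nat \<Rightarrow> real) \<Rightarrow> nat \<Rightarrow> (real \<Rightarrow> real) \<Rightarrow> real \<Rightarrow> real" where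
  "iter_integral a 0 f = f"
| "iter_integral a (Suc m) f =
     (\<lambda>x. interval_lebesgue_integral lborel (ereal (a m)) (ereal x) (iter_integral a m f))"

end

theory Submission imports Defs begin

text \<open>Everything rests on one property of \<open>g\<close>: it is eventually monotone with limit \<open>0\<close>.  For such a
function and a fixed \<open>B\<close>, any two values of \<open>g\<close> at points within distance \<open>B\<close> of \<open>k\<close> differ by at
most \<open>\<bar>g (k + B) - g (k - B)\<bar>\<close>, and these bounds telescope to a convergent series
(\<open>eventually_monotone_increment_majorant\<close>).  The integral of \<open>g\<close> over \<open>[k, k + 1]\<close> is an average of
such values, so the Weierstrass test gives uniform convergence of the series, call its sum \<open>E\<close>, on
\<open>(-1, B)\<close>.  Working on \<open>x > -1\<close> rather than \<open>x \<ge> 0\<close> makes \<open>0\<close> an interior point, which the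
two-sided derivatives at \<open>0\<close> require.

In the limit that defines \<open>\<Sigma>g\<close> each summand \<open>g (k) - g (x + k)\<close> is the difference of the \<open>k\<close>-th terms of
\<open>E\<close> at \<open>0\<close> and at \<open>x\<close>; hence \<open>\<Sigma>g (x) = E (0) - g (x) - E (x)\<close>.  Shifting the index gives
\<open>E (x + 1) = E (x) - g (x + 1)\<close>, so that \<open>\<Sigma>g (t + 1) = E (0) - E (t)\<close>.  Every term of \<open>E\<close> has mean \<open>0\<close> over
\<open>[0, 1]\<close>, therefore \<open>\<sigma>[g] = E (0)\<close>, which is the formula in (b).  As \<open>\<Sigma>g (1) = 0\<close> and the asymptotic degree
is \<open>-1\<close>, the constant \<open>\<gamma>[g]\<close> is the integral of \<open>\<Sigma>g\<close> over \<open>[1, 2]\<close>, that is \<open>\<sigma>[g]\<close>.  Part (c) follows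
because integration from a fixed base point preserves uniform convergence on a compact interval.

For part (d), let \<open>g\<close> be \<open>r\<close> times continuously differentiable and in \<open>K\<^sup>r\<close>.  Equispaced nodes turn
\<open>r\<close>-convexity into a sign of the finite differences of order \<open>r + 1\<close>, and letting the step tend to \<open>0\<close>
shows that the \<open>r\<close>-th derivative is eventually monotone
(\<open>K_class_top_derivative_eventually_monotone\<close>).  A function with an eventually monotone derivative is
itself eventually monotone, and if it tends to \<open>0\<close> so does the derivative; hence all derivatives up to
order \<open>r\<close> are eventually monotone with limit \<open>0\<close>.  By the mean value theorem the values of the \<open>j\<close>-th
derivative are then dominated by unit increments of the \<open>(j - 1)\<close>-st one, to which the majorant above
applies again (\<open>uniform_limit_derivative_series\<close>).  So all differentiated series converge uniformly, and
term-by-term differentiation is justified.\<close>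

section \<open>Finite differences and higher-order convexity\<close>

definition step_diff :: "real \<Rightarrow> (real \<Rightarrow> real) \<Rightarrow> real \<Rightarrow> real" where
  "step_diff h f = (\<lambda>x. f (x + h) - f x)"

lemma step_diff_iterate:
  "(step_diff h ^^ n) f x = (\<Sum>k\<le>n. (-1) ^ (n + k) * real (n choose k) * f (x + real k * h))"
proof (induction n arbitrary: x)
  case 0
  then show ?case by simp
next
  case (Suc n)
  let ?a = "\<lambda>k. f (x + real k * h)"
  let ?s = "\<lambda>k. (-1::real) ^ (n + k)"
  have "(step_diff h ^^ Suc n) f x = (step_diff h ^^ n) f (x + h) - (step_diff h ^^ n) f x"
    by (simp add: step_diff_def)
  also have "(step_diff h ^^ n) f (x + h) = (\<Sum>k\<le>n. ?s k * real (n choose k) * ?a (Suc k))"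
    unfolding Suc by (simp add: algebra_simps)
  also have "(step_diff h ^^ n) f x = (\<Sum>k\<le>Suc n. ?s k * real (n choose k) * ?a k)"
    unfolding Suc by (simp add: binomial_eq_0)
  also have "\<dots> = ?s 0 * ?a 0 - (\<Sum>k\<le>n. ?s k * real (n choose Suc k) * ?a (Suc k))"
    by (subst sum.atMost_Suc_shift) (simp add: sum_negf)
  also have "(\<Sum>k\<le>n. ?s k * real (n choose k) * ?a (Suc k)) - \<dots>
      = (\<Sum>k\<le>n. ?s k * real (Suc n choose Suc k) * ?a (Suc k)) - ?s 0 * ?a 0"
    by (simp add: sum.distrib algebra_simps)
  also have "\<dots> = (\<Sum>k\<le>Suc n. (-1) ^ (Suc n + k) * real (Suc n choose k) * ?a k)"
    by (subst sum.atMost_Suc_shift) simp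
  finally show ?case .
qed

lemma prod_equispaced_node_differences:
  assumes "k \<le> n"
  shows "(\<Prod>j\<in>{..n} - {k}. (x + real k * h) - (x + real j * h))
    = (-1) ^ (n + k) * fact k * fact (n - k) * h ^ n"
  using assms
proof (induction n rule: dec_induct)
  case base
  have "(\<Prod>j<k. (real k - real j)) = fact k"
    by (simp add: fact_prod_rev of_nat_diff atLeast0LessThan)
  then have "(\<Prod>j<k. (real k - real j) * h) = fact k * h ^ k"
    by (simp add: prod.distrib)
  moreover have "{..k} - {k} = {..<k}" by auto
  ultimately show ?case
    by (simp add: left_diff_distrib mult_2 [symmetric] flip: power_add)
next
  case (step n)
  have "{..Suc n} - {k} = insert (Suc n) ({..n} - {k})" using step by auto
  moreover have "Suc n - k = Suc (n - k)" using step by simp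
  moreover have "real k - real (Suc n) = - real (Suc (n - k))" using step by (simp add: of_nat_diff)
  then have "(x + real k * h) - (x + real (Suc n) * h) = - real (Suc (n - k)) * h"
    by (metis add_diff_cancel_left left_diff_distrib)
  ultimately show ?case
    using step.IH step.hyps by (simp add: mult_ac del: of_nat_Suc)
qed

lemma divided_diff_equispaced:
  assumes "h \<noteq> 0"
  shows "divided_diff f n (\<lambda>i. x + real i * h) = (step_diff h ^^ n) f x / (fact n * h ^ n)"
proof -
  have "f (x + real k * h) / (\<Prod>j\<in>{..n} - {k}. (x + real k * h) - (x + real j * h))
      = (-1) ^ (n + k) * real (n choose k) * f (x + real k * h) / (fact n * h ^ n)" if "k \<le> n" for k
  proof -
    have 1: "(-1::real) ^ (n + k) * (-1) ^ (n + k) = 1"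
      by (simp add: power_add [symmetric] mult_2 [symmetric])
    have 2: "a / (s * p * q * w) = s * (F / (p * q)) * a / (F * w)"
      if "s * s = 1" "p \<noteq> 0" "q \<noteq> 0" "w \<noteq> 0" "F \<noteq> 0" for a s p q w F :: real
      using that by (auto simp: square_eq_1_iff field_simps)
    show ?thesis
      unfolding prod_equispaced_node_differences [OF that] binomial_fact [OF that]
      by (rule 2) (use 1 assms in auto)
  qed
  then show ?thesis
    by (simp add: divided_diff_def step_diff_iterate sum_divide_distrib)
qed

text \<open>This is the only way in which higher-order convexity enters: on equispaced nodes it prescribes the sign
of an iterated difference.\<close>

lemma divided_diff_equispaced_sign:
  assumes "h > 0"
  shows "divided_diff f n (\<lambda>i. x + real i * h) \<ge> 0 \<longleftrightarrow> (step_diff h ^^ n) f x \<ge> 0"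
    and "divided_diff f n (\<lambda>i. x + real i * h) \<le> 0 \<longleftrightarrow> (step_diff h ^^ n) f x \<le> 0"
proof -
  have "fact n * h ^ n > 0" using assms by simp
  moreover have "divided_diff f n (\<lambda>i. x + real i * h) = (step_diff h ^^ n) f x / (fact n * h ^ n)"
    using assms by (intro divided_diff_equispaced) simp
  ultimately show "divided_diff f n (\<lambda>i. x + real i * h) \<ge> 0 \<longleftrightarrow> (step_diff h ^^ n) f x \<ge> 0"
    "divided_diff f n (\<lambda>i. x + real i * h) \<le> 0 \<longleftrightarrow> (step_diff h ^^ n) f x \<le> 0"
    by (simp_all only: pos_le_divide_eq pos_divide_le_eq mult_zero_left)
qed

text \<open>An iterated difference of order \<open>n\<close> is an ordinary difference of one of order \<open>n - 1\<close>, and differencing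
commutes with differentiation; so the mean value theorem can be applied \<open>n\<close> times.  The function
\<open>F j\<close> plays the role of the \<open>j\<close>-th derivative of \<open>F 0\<close>.\<close>

lemma step_diff_mean_value:
  assumes "h > 0"
    and "\<And>j y. j < n \<Longrightarrow> y \<ge> x \<Longrightarrow> (F j has_real_derivative F (Suc j) y) (at y)"
  shows "\<exists>\<xi>. x \<le> \<xi> \<and> \<xi> \<le> x + real n * h \<and> (step_diff h ^^ n) (F 0) x = h ^ n * F n \<xi>"
  using assms(2)
proof (induction n arbitrary: F)
  case 0
  then show ?case by auto
next
  case (Suc n)
  let ?G = "\<lambda>j. step_diff h (F j)"
  have "(?G j has_real_derivative ?G (Suc j) y) (at y)" if "j < n" "y \<ge> x" for j y
    unfolding step_diff_def using that Suc.prems [of j] \<open>h > 0\<close>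
    by (intro DERIV_diff) (auto simp: DERIV_shift [symmetric])
  then obtain \<xi> where \<xi>: "x \<le> \<xi>" "\<xi> \<le> x + real n * h"
      "(step_diff h ^^ n) (?G 0) x = h ^ n * ?G n \<xi>"
    using Suc.IH [of ?G] by blast
  obtain z where z: "\<xi> < z" "z < \<xi> + h" "F n (\<xi> + h) - F n \<xi> = (\<xi> + h - \<xi>) * F (Suc n) z"
    using MVT2 [of \<xi> "\<xi> + h" "F n" "F (Suc n)"] \<open>h > 0\<close> \<xi>(1) Suc.prems by auto
  have "(step_diff h ^^ Suc n) (F 0) x = h ^ Suc n * F (Suc n) z"
    using \<xi>(3) z(3) by (simp add: funpow_swap1 step_diff_def)
  then show ?case
    using \<xi> z by (intro exI [of _ z]) (auto simp: algebra_simps)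
qed

text \<open>If differences of order \<open>r + 1\<close> are nonnegative, then those of order \<open>r\<close> with step \<open>h\<close> increase along
each progression of step \<open>h\<close>.  Choosing \<open>h\<close> so that a progression leads from \<open>s\<close> to \<open>t\<close>, and writing the
differences at \<open>s\<close> and \<open>t\<close> as values of \<open>F r\<close> near \<open>s\<close> and \<open>t\<close>, one obtains \<open>F r s \<le> F r t\<close> as \<open>h\<close>
tends to \<open>0\<close>.\<close>

lemma mono_on_top_derivative:
  assumes deriv: "\<And>j y. j < r \<Longrightarrow> y \<ge> a \<Longrightarrow> (F j has_real_derivative F (Suc j) y) (at y)"
    and cont: "continuous_on {a..} (F r)"
    and diff: "\<And>h y. h > 0 \<Longrightarrow> y \<ge> a \<Longrightarrow> (step_diff h ^^ Suc r) (F 0) y \<ge> 0"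
  shows "mono_on {a..} (F r)"
proof (rule mono_onI)
  fix s t assume st: "s \<in> {a..}" "t \<in> {a..}" "s \<le> t"
  show "F r s \<le> F r t"
  proof (cases "s = t")
    case False
    define h where "h n = (t - s) / real (Suc n)" for n
    have h0: "h n > 0" for n using False st by (simp add: h_def)
    have hlim: "h \<longlonglongrightarrow> 0"
      unfolding h_def by (rule LIMSEQ_Suc) (rule lim_const_over_n)
    have "\<exists>\<xi> \<zeta>. s \<le> \<xi> \<and> \<xi> \<le> s + real r * h n \<and> t \<le> \<zeta> \<and> \<zeta> \<le> t + real r * h n
        \<and> F r \<xi> \<le> F r \<zeta>" for n
    proof -
      let ?D = "(step_diff (h n) ^^ r) (F 0)"
      have mono: "?D s \<le> ?D (s + real m * h n)" for m
      proof (induction m)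
        case (Suc m)
        have "s + real m * h n \<ge> a" using st h0 [of n] by (simp add: add_increasing2)
        then have "?D (s + real m * h n) \<le> ?D (s + real m * h n + h n)"
          using diff [OF h0, of "s + real m * h n" n] by (simp add: step_diff_def)
        with Suc show ?case by (simp add: algebra_simps)
      qed simp
      have t: "s + real (Suc n) * h n = t" by (simp add: h_def)
      have le: "?D s \<le> ?D t" using mono [of "Suc n"] unfolding t .
      have mvt: "\<exists>\<xi>. c \<le> \<xi> \<and> \<xi> \<le> c + real r * h n \<and> ?D c = h n ^ r * F r \<xi>" if "c \<ge> a" for c
        by (rule step_diff_mean_value [OF h0]) (use deriv that in simp)
      obtain \<xi> where \<xi>: "s \<le> \<xi>" "\<xi> \<le> s + real r * h n" "?D s = h n ^ r * F r \<xi>"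
        using mvt [of s] st by auto
      obtain \<zeta> where \<zeta>: "t \<le> \<zeta>" "\<zeta> \<le> t + real r * h n" "?D t = h n ^ r * F r \<zeta>"
        using mvt [of t] st by auto
      have "F r \<xi> \<le> F r \<zeta>" using le \<xi>(3) \<zeta>(3) h0 [of n] by simp
      with \<xi> \<zeta> show ?thesis by blast
    qed
    then obtain \<xi> \<zeta> where *: "\<And>n. s \<le> \<xi> n" "\<And>n. \<xi> n \<le> s + real r * h n"
      "\<And>n. t \<le> \<zeta> n" "\<And>n. \<zeta> n \<le> t + real r * h n" "\<And>n. F r (\<xi> n) \<le> F r (\<zeta> n)"
      by metis
    have lim: "(\<lambda>n. c + real r * h n) \<longlonglongrightarrow> c" for c
      using tendsto_add [OF tendsto_const tendsto_mult [OF tendsto_const hlim], of c "real r"] by simp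
    have "\<xi> \<longlonglongrightarrow> s" "\<zeta> \<longlonglongrightarrow> t"
      using * by (auto intro!: tendsto_sandwich [OF _ _ tendsto_const lim])
    then have "(\<lambda>n. F r (\<xi> n)) \<longlonglongrightarrow> F r s" "(\<lambda>n. F r (\<zeta> n)) \<longlonglongrightarrow> F r t"
      using st * by (auto intro!: continuous_on_tendsto_compose [OF cont] always_eventually
          intro: order_trans)
    then show ?thesis using *(5) by (intro LIMSEQ_le) auto
  qed simp
qed

lemma C_class_has_derivative:
  assumes "g \<in> C_class r" "j < r" "x > 0"
  shows "((deriv ^^ j) g has_real_derivative (deriv ^^ Suc j) g x) (at x)"
  using assms by (auto simp: C_class_def DERIV_deriv_iff_real_differentiable)

lemma C_class_continuous_on:
  assumes "g \<in> C_class r" "j \<le> r"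
  shows "continuous_on {0<..} ((deriv ^^ j) g)"
  using assms by (auto simp: C_class_def)

section \<open>Eventually monotone functions that vanish at infinity\<close>

definition eventually_monotone :: "(real \<Rightarrow> real) \<Rightarrow> bool" where
  "eventually_monotone h \<longleftrightarrow> (\<exists>b>0. mono_on {b..} h \<or> antimono_on {b..} h)"

lemma mono_on_uminus_iff:
  fixes h :: "real \<Rightarrow> real"
  shows "mono_on A (\<lambda>x. - h x) \<longleftrightarrow> antimono_on A h"
  by (auto simp: monotone_on_def)

text \<open>Concavity is reduced to convexity by passing to the negatives of \<open>g\<close> and its derivatives.\<close>

lemma K_class_top_derivative_eventually_monotone:
  assumes "g \<in> C_class r" "g \<in> K_class r"
  shows "eventually_monotone ((deriv ^^ r) g)"
proof -
  obtain a where a: "a > 0" and pc: "p_convex_on r {a..} g \<or> p_concave_on r {a..} g"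
    using assms by (auto simp: K_class_def)
  have nodes: "strict_mono_on {..r + 1} (\<lambda>i. y + real i * h)"
      "(\<lambda>i. y + real i * h) ` {..r + 1} \<subseteq> {a..}" if "h > 0" "y \<ge> a" for h y
    using that by (auto simp: strict_mono_on_def add_increasing2)
  have d: "((deriv ^^ j) g has_real_derivative (deriv ^^ Suc j) g y) (at y)" if "j < r" "y \<ge> a" for j y
    using C_class_has_derivative [OF assms(1) that(1)] that a by simp
  have c: "continuous_on {a..} ((deriv ^^ r) g)"
    by (rule continuous_on_subset [OF C_class_continuous_on [OF assms(1) order_refl]]) (use a in auto)
  from pc show ?thesis
  proof
    assume cv: "p_convex_on r {a..} g"
    have "(step_diff h ^^ Suc r) ((deriv ^^ 0) g) y \<ge> 0" if "h > 0" "y \<ge> a" for h y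
    proof -
      have "0 \<le> divided_diff g (r + 1) (\<lambda>i. y + real i * h)"
        using cv nodes [OF that] unfolding p_convex_on_def by blast
      then show ?thesis
        using divided_diff_equispaced_sign(1) [OF that(1), of g "r + 1" y] by simp
    qed
    then have "mono_on {a..} ((deriv ^^ r) g)"
      using mono_on_top_derivative [of r a "\<lambda>j. (deriv ^^ j) g"] d c by blast
    then show ?thesis using a by (auto simp: eventually_monotone_def)
  next
    assume cv: "p_concave_on r {a..} g"
    have "(step_diff h ^^ Suc r) (\<lambda>x. - (deriv ^^ 0) g x) y \<ge> 0" if "h > 0" "y \<ge> a" for h y
    proof -
      have "0 \<ge> divided_diff g (r + 1) (\<lambda>i. y + real i * h)"
        using cv nodes [OF that] unfolding p_concave_on_def by blast
      moreover have "(step_diff h ^^ Suc r) (\<lambda>x. - (deriv ^^ 0) g x) y = - (step_diff h ^^ Suc r) g y"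
        unfolding step_diff_iterate by (simp add: sum_negf)
      ultimately show ?thesis
        using divided_diff_equispaced_sign(2) [OF that(1), of g "r + 1" y] by simp
    qed
    moreover have "((\<lambda>x. - (deriv ^^ j) g x) has_real_derivative - (deriv ^^ Suc j) g y) (at y)"
      if "j < r" "y \<ge> a" for j y
      using d [OF that] by (rule DERIV_minus)
    moreover have "continuous_on {a..} (\<lambda>x. - (deriv ^^ r) g x)"
      using c by (rule continuous_on_minus)
    ultimately have "mono_on {a..} (\<lambda>x. - (deriv ^^ r) g x)"
      using mono_on_top_derivative [of r a "\<lambda>j x. - (deriv ^^ j) g x"] by blast
    then show ?thesis using a by (auto simp: eventually_monotone_def mono_on_uminus_iff)
  qed
qed


lemma eventually_monotone_uminus_iff:
  "eventually_monotone (\<lambda>x. - h x) \<longleftrightarrow> eventually_monotone h"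
  by (auto simp: eventually_monotone_def monotone_on_def)

lemma eventually_monotone_cases:
  assumes "eventually_monotone h"
  obtains b where "b > 0" "mono_on {b..} h" | b where "b > 0" "mono_on {b..} (\<lambda>x. - h x)"
  using assms by (auto simp: eventually_monotone_def mono_on_uminus_iff)

text \<open>Monotonicity squeezes the values of \<open>h\<close> between those at the neighbouring integers.\<close>

lemma mono_on_tendsto_0_at_top:
  fixes h :: "real \<Rightarrow> real"
  assumes mono: "mono_on {b..} h" and lim: "(\<lambda>n. h (real n)) \<longlonglongrightarrow> 0"
  shows "(h \<longlongrightarrow> 0) at_top"
proof (rule tendsto_sandwich)
  have nat: "((\<lambda>x. h (real (nat (r x)))) \<longlongrightarrow> 0) at_top"
    if "filterlim r at_top at_top" for r :: "real \<Rightarrow> int"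
    by (rule filterlim_compose [OF lim filterlim_compose [OF filterlim_nat_sequentially that]])
  show "((\<lambda>x::real. h (real (nat \<lfloor>x\<rfloor>))) \<longlongrightarrow> 0) at_top"
    by (rule nat) (rule filterlim_floor_sequentially)
  show "((\<lambda>x::real. h (real (nat \<lceil>x\<rceil>))) \<longlongrightarrow> 0) at_top"
    
  proof (rule nat)
    have "\<lfloor>x\<rfloor> \<le> \<lceil>x\<rceil>" for x :: real by linarith
    then show "filterlim ceiling at_top (at_top :: real filter)"
      by (intro filterlim_at_top_mono [OF filterlim_floor_sequentially] always_eventually) auto
  qed
  have between: "b \<le> real (nat \<lfloor>x\<rfloor>)" "real (nat \<lfloor>x\<rfloor>) \<le> x" "x \<le> real (nat \<lceil>x\<rceil>)"
    if x: "max 0 b + 1 \<le> x" for x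
  proof -
    have "real (nat \<lfloor>x\<rfloor>) = of_int \<lfloor>x\<rfloor>" using x by (simp add: le_max_iff_disj)
    moreover have "x - 1 < of_int \<lfloor>x\<rfloor>" "of_int \<lfloor>x\<rfloor> \<le> x" by linarith+
    ultimately show "b \<le> real (nat \<lfloor>x\<rfloor>)" "real (nat \<lfloor>x\<rfloor>) \<le> x" using x by linarith+
    show "x \<le> real (nat \<lceil>x\<rceil>)" by (rule real_nat_ceiling_ge)
  qed
  show "\<forall>\<^sub>F x in at_top. h (real (nat \<lfloor>x\<rfloor>)) \<le> h x"
    using eventually_ge_at_top [of "max 0 b + 1"]
  proof eventually_elim
    case (elim x)
    have "b \<le> x" using between [OF elim] by linarith
    then show ?case using between [OF elim] by (intro mono_onD [OF mono]) (auto simp del: of_nat_nat)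
  qed
  show "\<forall>\<^sub>F x in at_top. h x \<le> h (real (nat \<lceil>x\<rceil>))"
    using eventually_ge_at_top [of "max 0 b + 1"]
  proof eventually_elim
    case (elim x)
    have "b \<le> x" "b \<le> real (nat \<lceil>x\<rceil>)" using between [OF elim] by linarith+
    then show ?case using between(3) [OF elim] by (intro mono_onD [OF mono]) (auto simp del: of_nat_nat)
  qed
qed

lemma eventually_monotone_tendsto_0_at_top:
  assumes "eventually_monotone h" and "(\<lambda>n. h (real n)) \<longlonglongrightarrow> 0"
  shows "(h \<longlongrightarrow> 0) at_top"
  using assms(1)
proof (cases rule: eventually_monotone_cases)
  case (1 b)
  then show ?thesis using mono_on_tendsto_0_at_top assms(2) by blast
next
  case (2 b)
  have "((\<lambda>x. - h x) \<longlongrightarrow> 0) at_top"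
    using mono_on_tendsto_0_at_top [OF 2(2)] tendsto_minus [OF assms(2)] by simp
  then show ?thesis using tendsto_minus by fastforce
qed

text \<open>An increasing function with limit \<open>0\<close> is nonpositive, a decreasing one nonnegative; either way it
approaches \<open>0\<close> from one side.\<close>

lemma eventually_monotone_abs_decreasing:
  assumes "eventually_monotone h" and "(h \<longlongrightarrow> 0) at_top"
  shows "\<exists>b>0. \<forall>x\<ge>b. \<forall>y\<ge>x. \<bar>h y\<bar> \<le> \<bar>h x\<bar>"
proof -
  have nonpos: "f x \<le> 0" if "mono_on {b..} f" "(f \<longlongrightarrow> 0) at_top" "x \<ge> b" for f :: "real \<Rightarrow> real" and b x
    using that by (intro tendsto_lowerbound [OF that(2)] eventually_mono [OF eventually_ge_at_top [of x]])
      (auto intro: mono_onD)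
  from assms(1) show ?thesis
  proof (cases rule: eventually_monotone_cases)
    case (1 b)
    have "\<bar>h y\<bar> \<le> \<bar>h x\<bar>" if "x \<ge> b" "y \<ge> x" for x y
      using nonpos [OF 1(2) assms(2), of y] mono_onD [OF 1(2), of x y] that by auto
    then show ?thesis using 1 by blast
  next
    case (2 b)
    have "((\<lambda>x. - h x) \<longlongrightarrow> 0) at_top" using tendsto_minus [OF assms(2)] by simp
    then have "\<bar>h y\<bar> \<le> \<bar>h x\<bar>" if "x \<ge> b" "y \<ge> x" for x y
      using nonpos [OF 2(2), of y] mono_onD [OF 2(2), of x y] that by auto
    then show ?thesis using 2 by blast
  qed
qed

text \<open>A monotone derivative cannot change sign more than once, so it eventually has a constant sign.\<close>

lemma eventually_monotone_antiderivative:
  assumes deriv: "\<And>y. y > 0 \<Longrightarrow> (h has_real_derivative h' y) (at y)"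
    and "eventually_monotone h'"
  shows "eventually_monotone h"
proof -
  have main: "eventually_monotone f"
    if d: "\<And>y. y > 0 \<Longrightarrow> (f has_real_derivative f' y) (at y)"
      and b: "b > 0" and mono: "mono_on {b..} f'" for f f' :: "real \<Rightarrow> real" and b
  proof (cases "\<exists>c\<ge>b. f' c \<ge> 0")
    case True
    then obtain c where c: "c \<ge> b" "f' c \<ge> 0" by blast
    have "\<exists>D. (f has_real_derivative D) (at y) \<and> 0 \<le> D" if "y \<ge> c" for y
      using mono_onD [OF mono, of c y] d [of y] b c that by (intro exI [of _ "f' y"]) auto
    then have "f p \<le> f q" if "c \<le> p" "p \<le> q" for p q
      by (intro DERIV_nonneg_imp_nondecreasing [OF that(2)]) (use that in auto)
    then have "mono_on {c..} f" by (auto intro: mono_onI)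
    then show ?thesis using b c unfolding eventually_monotone_def by (intro exI [of _ c]) auto
  next
    case False
    then have "\<exists>D. (f has_real_derivative D) (at y) \<and> D \<le> 0" if "y \<ge> b" for y
      using d [of y] b that by (intro exI [of _ "f' y"]) force
    then have "f q \<le> f p" if "b \<le> p" "p \<le> q" for p q
      by (intro DERIV_nonpos_imp_nonincreasing [OF that(2)]) (use that in auto)
    then have "antimono_on {b..} f" by (auto intro: monotone_onI)
    then show ?thesis using b by (auto simp: eventually_monotone_def)
  qed
  from assms(2) show ?thesis
  proof (cases rule: eventually_monotone_cases)
    case (1 b)
    then show ?thesis using main deriv by blast
  next
    case (2 b)
    then show ?thesis
      using main [of "\<lambda>x. - h x" "\<lambda>x. - h' x" b] deriv DERIV_minus eventually_monotone_uminus_iff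
      by blast
  qed
qed

lemma unit_increment_mean_value:
  fixes h :: "real \<Rightarrow> real"
  assumes "\<And>y. y > 0 \<Longrightarrow> (h has_real_derivative h' y) (at y)" and "x > 0"
  obtains \<xi> where "x < \<xi>" "\<xi> < x + 1" "h (x + 1) - h x = h' \<xi>"
  using MVT2 [of x "x + 1" h h'] assms by auto

text \<open>For increasing \<open>h'\<close> the mean value theorem gives \<open>h x - h (x - 1) \<le> h' x \<le> h (x + 1) - h x\<close>, and both
bounds tend to \<open>0\<close>.\<close>

lemma eventually_monotone_derivative_tendsto_0:
  assumes deriv: "\<And>y. y > 0 \<Longrightarrow> (h has_real_derivative h' y) (at y)"
    and "eventually_monotone h'" and lim: "(h \<longlongrightarrow> 0) at_top"
  shows "(h' \<longlongrightarrow> 0) at_top"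
proof -
  have main: "(f' \<longlongrightarrow> 0) at_top"
    if d: "\<And>y. y > 0 \<Longrightarrow> (f has_real_derivative f' y) (at y)" and lim: "(f \<longlongrightarrow> 0) at_top"
      and b: "b > 0" and mono: "mono_on {b..} f'" for f f' :: "real \<Rightarrow> real" and b
  proof (rule tendsto_sandwich)
    have shift: "((\<lambda>x. f (x + c)) \<longlongrightarrow> 0) at_top" for c
      by (rule filterlim_compose [OF lim])
        (subst add.commute, rule filterlim_tendsto_add_at_top [OF tendsto_const filterlim_ident])
    show "((\<lambda>x. f x - f (x + (- 1))) \<longlongrightarrow> 0) at_top"
      using tendsto_diff [OF lim shift [of "- 1"]] by simp
    show "((\<lambda>x. f (x + 1) - f x) \<longlongrightarrow> 0) at_top"
      using tendsto_diff [OF shift [of 1] lim] by simp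
    show "\<forall>\<^sub>F x in at_top. f x - f (x + (- 1)) \<le> f' x"
      using eventually_ge_at_top [of "b + 1"]
    proof eventually_elim
      case (elim x)
      obtain \<xi> where "x - 1 < \<xi>" "\<xi> < x" "f x - f (x - 1) = f' \<xi>"
        using unit_increment_mean_value [of f f' "x - 1"] d elim b by auto
      then show ?case using mono_onD [OF mono, of \<xi> x] elim by auto
    qed
    show "\<forall>\<^sub>F x in at_top. f' x \<le> f (x + 1) - f x"
      using eventually_ge_at_top [of "b"]
    proof eventually_elim
      case (elim x)
      obtain \<xi> where "x < \<xi>" "\<xi> < x + 1" "f (x + 1) - f x = f' \<xi>"
        using unit_increment_mean_value [of f f' x] d elim b by auto
      then show ?case using mono_onD [OF mono, of x \<xi>] elim by auto
    qed
  qed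
  from assms(2) show ?thesis
  proof (cases rule: eventually_monotone_cases)
    case (1 b)
    then show ?thesis using main [of h h' b] deriv lim by blast
  next
    case (2 b)
    have "((\<lambda>x. - h x) has_real_derivative - h' y) (at y)" if "y > 0" for y
      by (rule DERIV_minus [OF deriv [OF that]])
    moreover have "((\<lambda>x. - h x) \<longlongrightarrow> 0) at_top"
      using tendsto_minus [OF lim] by simp
    ultimately have "((\<lambda>x. - h' x) \<longlongrightarrow> 0) at_top"
      using 2 by (rule main)
    then show ?thesis using tendsto_minus by fastforce
  qed
qed

text \<open>Monotonicity descends from the derivative of order \<open>r\<close> to lower orders, whereas the limit \<open>0\<close> ascends
from \<open>F 0\<close>; the induction on \<open>r\<close> combines the two.\<close>

lemma derivatives_eventually_monotone_vanishing:
  assumes "\<And>j y. j < r \<Longrightarrow> y > 0 \<Longrightarrow> (F j has_real_derivative F (Suc j) y) (at y)"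
    and "eventually_monotone (F r)" and "(F 0 \<longlongrightarrow> 0) at_top" and "j \<le> r"
  shows "eventually_monotone (F j) \<and> (F j \<longlongrightarrow> 0) at_top"
  using assms
proof (induction r arbitrary: j)
  case (Suc r)
  have r: "eventually_monotone (F r)"
    using eventually_monotone_antiderivative [of "F r" "F (Suc r)"] Suc.prems by blast
  then have IH: "eventually_monotone (F i) \<and> (F i \<longlongrightarrow> 0) at_top" if "i \<le> r" for i
    using Suc.IH [of i] Suc.prems that by auto
  have "(F (Suc r) \<longlongrightarrow> 0) at_top"
    using eventually_monotone_derivative_tendsto_0 [of "F r" "F (Suc r)"] Suc.prems IH [of r] by blast
  then show ?case using IH Suc.prems by (cases "j = Suc r") auto
qed auto

lemma summable_shifted_difference:
  fixes u :: "nat \<Rightarrow> real"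
  assumes "u \<longlonglongrightarrow> c"
  shows "summable (\<lambda>k. u (k + p) - u k)"
proof (induction p)
  case (Suc p)
  have "summable (\<lambda>k. u (Suc k + p) - u (k + p))"
    by (rule telescope_summable) (rule LIMSEQ_ignore_initial_segment [OF assms])
  from summable_add [OF this Suc] show ?case by simp
qed simp

text \<open>The majorant is \<open>\<bar>h (k + B) - h (k - B)\<bar>\<close>, whose sum telescopes since \<open>h\<close> vanishes at infinity and the
differences eventually have constant sign.  It controls both the series
itself and its termwise derivatives.\<close>

lemma eventually_monotone_increment_majorant:
  assumes "eventually_monotone h" and lim: "(h \<longlongrightarrow> 0) at_top"
  shows "\<exists>M. summable M \<and> (\<forall>\<^sub>F k in sequentially. \<forall>y z.
    \<bar>y - real k\<bar> \<le> real B \<longrightarrow> \<bar>z - real k\<bar> \<le> real B \<longrightarrow> \<bar>h y - h z\<bar> \<le> M k)"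
proof -
  have main: "\<exists>M. summable M \<and> (\<forall>\<^sub>F k in sequentially. \<forall>y z.
      \<bar>y - real k\<bar> \<le> real B \<longrightarrow> \<bar>z - real k\<bar> \<le> real B \<longrightarrow> \<bar>f y - f z\<bar> \<le> M k)"
    if lim: "(f \<longlongrightarrow> 0) at_top" and mono: "mono_on {b..} f" for f :: "real \<Rightarrow> real" and b
  proof (intro exI conjI)
    let ?u = "\<lambda>n. f (real n - real B)"
    let ?M = "\<lambda>k. ?u (k + 2 * B) - ?u k"
    have "filterlim (\<lambda>n. - real B + real n) at_top sequentially"
      by (rule filterlim_tendsto_add_at_top [OF tendsto_const filterlim_real_sequentially])
    from filterlim_compose [OF lim this] have "?u \<longlonglongrightarrow> 0" by simp
    then show "summable ?M" by (rule summable_shifted_difference)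
    show "\<forall>\<^sub>F k in sequentially. \<forall>y z.
        \<bar>y - real k\<bar> \<le> real B \<longrightarrow> \<bar>z - real k\<bar> \<le> real B \<longrightarrow> \<bar>f y - f z\<bar> \<le> ?M k"
      using eventually_ge_at_top [of "nat \<lceil>b\<rceil> + B"]
    proof eventually_elim
      case (elim k)
      have k: "b \<le> real k - real B" using elim by linarith
      have "?u k \<le> f y \<and> f y \<le> ?u (k + 2 * B)" if "\<bar>y - real k\<bar> \<le> real B" for y
        using that k by (auto intro!: mono_onD [OF mono])
      then show ?case by (smt (verit))
    qed
  qed
  from assms(1) show ?thesis
  proof (cases rule: eventually_monotone_cases)
    case (1 b)
    then show ?thesis using main lim by blast
  next
    case (2 b)
    have "\<bar>- h y - - h z\<bar> = \<bar>h y - h z\<bar>" for y z by simp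
    then show ?thesis using main [of "\<lambda>x. - h x" b] 2 tendsto_minus [OF lim] by simp
  qed
qed


section \<open>Repeated integration of uniformly convergent series\<close>

lemma interval_integrable_between:
  fixes f :: "real \<Rightarrow> real"
  assumes "continuous_on {l..u} f" "c \<in> {l..u}" "x \<in> {l..u}"
  shows "interval_lebesgue_integrable lborel (ereal c) (ereal x) f"
proof (cases "c \<le> x")
  case True
  then show ?thesis
    using assms by (intro interval_integrable_continuous_on) (auto intro: continuous_on_subset)
next
  case False
  then have "interval_lebesgue_integrable lborel (ereal x) (ereal c) f"
    using assms by (intro interval_integrable_continuous_on) (auto intro: continuous_on_subset)
  then show ?thesis by (simp add: interval_integrable_endpoints_reverse)
qed

lemma interval_integral_abs_le:
  fixes f :: "real \<Rightarrow> real"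
  assumes "continuous_on {l..u} f" "c \<in> {l..u}" "x \<in> {l..u}" "\<And>t. t \<in> {l..u} \<Longrightarrow> \<bar>f t\<bar> \<le> e"
  shows "\<bar>LBINT y=c..x. f y\<bar> \<le> e * \<bar>x - c\<bar>"
proof -
  have main: "\<bar>LBINT y=p..q. f y\<bar> \<le> e * (q - p)" if "p \<le> q" "p \<in> {l..u}" "q \<in> {l..u}" for p q
  proof -
    have c: "continuous_on {p..q} f"
      using assms(1) by (rule continuous_on_subset) (use that in auto)
    then have "(LBINT y=p..q. f y) = integral {p..q} f"
      using that(1) by (intro interval_integral_eq_integral borel_integrable_atLeastAtMost')
    then show ?thesis
      using integral_bound [OF that(1) c, of e] assms(4) that by auto
  qed
  show ?thesis
  proof (cases "c \<le> x")
    case True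
    then show ?thesis using main [of c x] assms by simp
  next
    case False
    have "(LBINT y=c..x. f y) = - (LBINT y=x..c. f y)"
      by (rule interval_integral_endpoints_reverse)
    then show ?thesis using main [of x c] assms False by simp
  qed
qed

lemma indefinite_integral_continuous_on:
  fixes f :: "real \<Rightarrow> real"
  assumes "continuous_on {l..u} f" "c \<in> {l..u}"
  shows "continuous_on {l..u} (\<lambda>x. LBINT y=c..x. f y)"
  unfolding continuous_on_eq_continuous_within
proof
  fix x assume "x \<in> {l..u}"
  with assms have "((\<lambda>x. LBINT y=c..x. f y) has_vector_derivative f x) (at x within {l..u})"
    by (intro interval_integral_FTC2) auto
  then show "continuous (at x within {l..u}) (\<lambda>x. LBINT y=c..x. f y)"
    by (rule has_vector_derivative_continuous)
qed

lemma uniform_limit_series_integral: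
  fixes f :: "nat \<Rightarrow> real \<Rightarrow> real"
  assumes cont: "\<And>k. continuous_on {l..u} (f k)"
    and lim: "uniform_limit {l..u} (\<lambda>N x. \<Sum>k<N. f k x) F sequentially"
    and c: "c \<in> {l..u}"
  shows "uniform_limit {l..u} (\<lambda>N x. \<Sum>k<N. LBINT y=c..x. f k y) (\<lambda>x. LBINT y=c..x. F y) sequentially"
proof (rule uniform_limitI)
  fix e :: real assume "e > 0"
  have contS: "continuous_on {l..u} (\<lambda>x. \<Sum>k<N. f k x)" for N
    by (intro continuous_on_sum cont)
  have contF: "continuous_on {l..u} F"
    by (rule uniform_limit_theorem [OF always_eventually lim]) (use contS in auto)
  \<comment> \<open>The summand \<open>1\<close> keeps the denominator positive when the interval is a single point.\<close>
  define d where "d = e / (u - l + 1)"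
  have ul: "u - l + 1 > 0" using c by auto
  then have d: "d > 0" "d * (u - l) < e"
    using \<open>e > 0\<close> by (auto simp: d_def field_simps)
  show "\<forall>\<^sub>F N in sequentially. \<forall>x\<in>{l..u}.
      dist (\<Sum>k<N. LBINT y=c..x. f k y) (LBINT y=c..x. F y) < e"
    using uniform_limitD [OF lim d(1)]
  proof eventually_elim
    case (elim N)
    show ?case
    proof
      fix x assume x: "x \<in> {l..u}"
      have sum: "interval_lebesgue_integrable lborel (ereal c) (ereal x) (\<lambda>y. \<Sum>k<n. f k y)
          \<and> (LBINT y=c..x. (\<Sum>k<n. f k y)) = (\<Sum>k<n. LBINT y=c..x. f k y)" for n
        by (induction n) (use interval_integrable_between [OF cont c x] in auto)
      have "(\<Sum>k<N. LBINT y=c..x. f k y) - (LBINT y=c..x. F y)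
          = (LBINT y=c..x. (\<Sum>k<N. f k y) - F y)"
        using sum interval_integrable_between [OF contF c x] by auto
      also have "\<bar>\<dots>\<bar> \<le> d * \<bar>x - c\<bar>"
        using elim by (intro interval_integral_abs_le [OF continuous_on_diff [OF contS contF] c x])
          (auto simp: dist_real_def less_imp_le)
      also have "\<dots> \<le> d * (u - l)"
        using d(1) c x by (intro mult_left_mono) auto
      finally show "dist (\<Sum>k<N. LBINT y=c..x. f k y) (LBINT y=c..x. F y) < e"
        using d(2) by (simp add: dist_real_def)
    qed
  qed
qed

text \<open>The induction needs all base points in one compact interval, and continuity of the integrated terms so
that they can be integrated again.\<close>

lemma uniform_limit_series_iter_integral:
  fixes f :: "nat \<Rightarrow> real \<Rightarrow> real"
  assumes cont: "\<And>k. continuous_on {l..u} (f k)"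
    and lim: "uniform_limit {l..u} (\<lambda>N x. \<Sum>k<N. f k x) F sequentially"
    and a: "\<And>i. i < m \<Longrightarrow> a i \<in> {l..u}"
  shows "(\<forall>k. continuous_on {l..u} (iter_integral a m (f k)))
    \<and> uniform_limit {l..u} (\<lambda>N x. \<Sum>k<N. iter_integral a m (f k) x) (iter_integral a m F) sequentially"
  using a
proof (induction m)
  case 0
  then show ?case using cont lim by simp
next
  case (Suc m)
  then have IH: "\<And>k. continuous_on {l..u} (iter_integral a m (f k))"
    "uniform_limit {l..u} (\<lambda>N x. \<Sum>k<N. iter_integral a m (f k) x) (iter_integral a m F) sequentially"
    and am: "a m \<in> {l..u}" by auto
  show ?case
    using indefinite_integral_continuous_on [OF IH(1) am] uniform_limit_series_integral [OF IH am]
    by simp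
qed

lemma series_iter_integral:
  fixes f :: "nat \<Rightarrow> real \<Rightarrow> real"
  assumes cont: "\<And>k. continuous_on {0..} (f k)"
    and lim: "\<And>B. uniform_limit {0..B} (\<lambda>N x. \<Sum>k<N. f k x) F sequentially"
    and a: "\<And>i. 0 \<le> a i" and x: "0 \<le> x"
  shows "interval_lebesgue_integrable lborel (ereal (a m)) (ereal x) (iter_integral a m (f k))"
    and "interval_lebesgue_integrable lborel (ereal (a m)) (ereal x) (iter_integral a m F)"
    and "(\<lambda>k. iter_integral a (Suc m) (f k) x) sums iter_integral a (Suc m) F x"
proof -
  \<comment> \<open>Any bound for \<open>x\<close> and the base points \<open>a 0, \<dots>, a m\<close> would do; all of them are nonnegative.\<close>
  define B where "B = x + (\<Sum>i\<le>m. a i)"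
  have aB: "a i \<in> {0..B}" if "i \<le> m" for i
    using a x member_le_sum [of i "{..m}" a] that by (auto simp: B_def)
  have xB: "x \<in> {0..B}" using a x by (auto simp: B_def sum_nonneg)
  have cB: "continuous_on {0..B} (f k)" for k
    using cont by (rule continuous_on_subset) auto
  have *: "(\<forall>k. continuous_on {0..B} (iter_integral a n (f k)))
      \<and> uniform_limit {0..B} (\<lambda>N x. \<Sum>k<N. iter_integral a n (f k) x) (iter_integral a n F) sequentially"
    if "n \<le> Suc m" for n
    using that aB by (intro uniform_limit_series_iter_integral cB lim) auto
  have cm: "continuous_on {0..B} (iter_integral a m (f k))" for k
    using * [of m] by auto
  have "continuous_on {0..B} (iter_integral a m F)"
  proof (rule uniform_limit_theorem [OF always_eventually])
    show "\<forall>N. continuous_on {0..B} (\<lambda>x. \<Sum>k<N. iter_integral a m (f k) x)"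
      using cm by (auto intro: continuous_on_sum)
  qed (use * [of m] in auto)
  then show "interval_lebesgue_integrable lborel (ereal (a m)) (ereal x) (iter_integral a m (f k))"
    "interval_lebesgue_integrable lborel (ereal (a m)) (ereal x) (iter_integral a m F)"
    using aB xB cm by (auto intro!: interval_integrable_between)
  show "(\<lambda>k. iter_integral a (Suc m) (f k) x) sums iter_integral a (Suc m) F x"
    using * [of "Suc m"] xB by (auto simp: sums_def simp del: iter_integral.simps dest: tendsto_uniform_limitI)
qed

section \<open>Uniform convergence of the series and of its derivatives\<close>

text \<open>The \<open>k\<close>-th term is the mean over \<open>t \<in> [k, k + 1]\<close> of \<open>g (x + k) - g t\<close>, and both arguments lie within
distance \<open>B + 1\<close> of \<open>k\<close>.\<close>

lemma uniform_limit_euler_series: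
  assumes cont: "continuous_on {0<..} g"
    and "eventually_monotone g" "(g \<longlongrightarrow> 0) at_top"
  shows "uniform_limit {-1<..<real B} (\<lambda>N x. \<Sum>k<N. euler_term g (Suc k) x) (euler_series g) sequentially"
proof -
  obtain M where M: "summable M" "\<forall>\<^sub>F k in sequentially. \<forall>y z.
      \<bar>y - real k\<bar> \<le> real (B + 1) \<longrightarrow> \<bar>z - real k\<bar> \<le> real (B + 1) \<longrightarrow> \<bar>g y - g z\<bar> \<le> M k"
    using eventually_monotone_increment_majorant [OF assms(2,3), of "B + 1"] by blast
  have "\<forall>\<^sub>F k in sequentially. \<forall>x\<in>{-1<..<real B}. norm (euler_term g (Suc k) x) \<le> M (Suc k)"
    using eventually_compose_filterlim [OF M(2) filterlim_Suc]
  proof eventually_elim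
    case (elim k)
    show ?case
    proof
      fix x assume x: "x \<in> {-1<..<real B}"
      let ?m = "real (Suc k)"
      have c: "continuous_on {?m..?m + 1} g"
        using cont by (rule continuous_on_subset) auto
      have "euler_term g (Suc k) x = integral {?m..?m + 1} (\<lambda>t. g (x + ?m) - g t)"
        unfolding euler_term_def
        by (subst Henstock_Kurzweil_Integration.integral_diff)
          (auto intro!: integrable_continuous_interval c simp del: of_nat_Suc)
      also have "norm \<dots> \<le> M (Suc k) * (?m + 1 - ?m)"
      proof (rule integral_bound)
        show "continuous_on {?m..?m + 1} (\<lambda>t. g (x + ?m) - g t)"
          by (intro continuous_intros c)
        show "norm (g (x + ?m) - g t) \<le> M (Suc k)" if "t \<in> {?m..?m + 1}" for t
          using elim x that by auto
      qed simp
      finally show "norm (euler_term g (Suc k) x) \<le> M (Suc k)" by simp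
    qed
  qed
  then have "uniform_limit {-1<..<real B} (\<lambda>N x. \<Sum>k<N. euler_term g (Suc k) x)
      (\<lambda>x. \<Sum>k. euler_term g (Suc k) x) sequentially"
    by (rule Weierstrass_m_test_ev) (use M(1) in \<open>simp add: summable_Suc_iff\<close>)
  moreover have "(\<lambda>x. \<Sum>k. euler_term g (Suc k) x) = euler_series g"
    by (simp add: euler_series_def fun_eq_iff)
  ultimately show ?thesis by simp
qed

text \<open>Since \<open>\<bar>h'\<bar>\<close> is eventually decreasing, \<open>\<bar>h' (y + 1)\<bar>\<close> is at most \<open>\<bar>h' \<xi>\<bar>\<close> for the intermediate
point \<open>\<xi>\<close> at which \<open>h (y + 1) - h y = h' \<xi>\<close>; so the increments of \<open>h\<close> dominate the series.  The radius
\<open>B + 2\<close> leaves room for the point \<open>y\<close>, which may be almost \<open>2\<close> below the index.\<close>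

lemma uniform_limit_derivative_series:
  assumes deriv: "\<And>y. y > 0 \<Longrightarrow> (h has_real_derivative h' y) (at y)"
    and h: "eventually_monotone h" "(h \<longlongrightarrow> 0) at_top"
    and h': "eventually_monotone h'" "(h' \<longlongrightarrow> 0) at_top"
  shows "uniform_limit {-1<..<real B} (\<lambda>N x. \<Sum>k<N. h' (x + real (Suc k)))
    (\<lambda>x. \<Sum>k. h' (x + real (Suc k))) sequentially"
proof -
  obtain M where M: "summable M" "\<forall>\<^sub>F k in sequentially. \<forall>y z.
      \<bar>y - real k\<bar> \<le> real (B + 2) \<longrightarrow> \<bar>z - real k\<bar> \<le> real (B + 2) \<longrightarrow> \<bar>h y - h z\<bar> \<le> M k"
    using eventually_monotone_increment_majorant [OF h, of "B + 2"] by blast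
  obtain b where b: "b > 0" "\<And>x y. x \<ge> b \<Longrightarrow> y \<ge> x \<Longrightarrow> \<bar>h' y\<bar> \<le> \<bar>h' x\<bar>"
    using eventually_monotone_abs_decreasing [OF h'] by blast
  have "\<forall>\<^sub>F k in sequentially. \<forall>x\<in>{-1<..<real B}. norm (h' (x + real (Suc k))) \<le> M (Suc k)"
    using eventually_compose_filterlim [OF M(2) filterlim_Suc] eventually_ge_at_top [of "nat \<lceil>b\<rceil> + 1"]
  proof eventually_elim
    case (elim k)
    show ?case
    proof
      fix x assume x: "x \<in> {-1<..<real B}"
      define y where "y = x + real k"
      have y: "y \<ge> b" using x elim(2) unfolding y_def by simp linarith
      obtain \<xi> where \<xi>: "y < \<xi>" "\<xi> < y + 1" "h (y + 1) - h y = h' \<xi>"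
        using unit_increment_mean_value [OF deriv, of y] y b(1) by (metis less_le_trans)
      have "\<bar>h' (y + 1)\<bar> \<le> \<bar>h (y + 1) - h y\<bar>"
        using b(2) [of \<xi> "y + 1"] \<xi> y by simp
      also have "\<dots> \<le> M (Suc k)"
        using elim(1) x by (auto simp: y_def)
      finally show "norm (h' (x + real (Suc k))) \<le> M (Suc k)"
        by (simp add: y_def add_ac)
    qed
  qed
  then show ?thesis
    by (rule Weierstrass_m_test_ev) (use M(1) in \<open>simp add: summable_Suc_iff\<close>)
qed


section \<open>Iterated derivatives\<close>

text \<open>Since \<open>deriv\<close> depends only on values near the point, a chain of derivatives on an open set determines
the iterated derivatives of every function that agrees with its first member there.\<close>

lemma iterated_deriv_eq:
  assumes S: "open S" and eq: "\<And>x. x \<in> S \<Longrightarrow> f x = F 0 x"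
    and deriv: "\<And>j x. j < r \<Longrightarrow> x \<in> S \<Longrightarrow> (F j has_real_derivative F (Suc j) x) (at x)"
    and "j \<le> r" "x \<in> S"
  shows "(deriv ^^ j) f x = F j x"
  using \<open>j \<le> r\<close> \<open>x \<in> S\<close>
proof (induction j arbitrary: x)
  case 0
  then show ?case using eq by simp
next
  case (Suc j)
  have "((deriv ^^ j) f has_real_derivative F (Suc j) x) (at x)"
    by (rule has_field_derivative_transform_within_open [OF deriv S]) (use Suc in auto)
  then show ?case by (simp add: DERIV_imp_deriv)
qed

lemma iterated_deriv_has_derivative:
  assumes S: "open S" and eq: "\<And>x. x \<in> S \<Longrightarrow> f x = F 0 x"
    and deriv: "\<And>j x. j < r \<Longrightarrow> x \<in> S \<Longrightarrow> (F j has_real_derivative F (Suc j) x) (at x)"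
    and "j < r" "x \<in> S"
  shows "((deriv ^^ j) f has_real_derivative F (Suc j) x) (at x)"
proof (rule has_field_derivative_transform_within_open [OF deriv [OF \<open>j < r\<close> \<open>x \<in> S\<close>] S \<open>x \<in> S\<close>])
  show "F j y = (deriv ^^ j) f y" if "y \<in> S" for y
    using iterated_deriv_eq [of S f F r j y, OF S eq deriv] \<open>j < r\<close> that by simp
qed

lemma C_classI:
  assumes eq: "\<And>x. x > 0 \<Longrightarrow> f x = F 0 x"
    and deriv: "\<And>j x. j < r \<Longrightarrow> x > 0 \<Longrightarrow> (F j has_real_derivative F (Suc j) x) (at x)"
    and cont: "\<And>j. j \<le> r \<Longrightarrow> continuous_on {0<..} (F j)"
  shows "f \<in> C_class r"
proof -
  have "(deriv ^^ j) f differentiable (at x)" if "j < r" "x > 0" for j x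
    using iterated_deriv_has_derivative [of "{0<..}" f F r j x] eq deriv that
    by (auto simp: real_differentiable_def)
  moreover have "continuous_on {0<..} ((deriv ^^ j) f)" if "j \<le> r" for j
  proof (rule continuous_on_eq [OF cont [OF that]])
    show "F j x = (deriv ^^ j) f x" if "x \<in> {0<..}" for x
      using iterated_deriv_eq [of "{0<..}" f F r j x] eq deriv that \<open>j \<le> r\<close> by auto
  qed
  ultimately show ?thesis by (auto simp: C_class_def)
qed

lemma deriv_shift_real:
  fixes f :: "real \<Rightarrow> real"
  shows "deriv (\<lambda>x. f (x + c)) = (\<lambda>x. deriv f (x + c))"
proof
  fix x
  show "deriv (\<lambda>x. f (x + c)) x = deriv f (x + c)"
    unfolding deriv_def by (simp only: DERIV_shift [of f _ x c])
qed

text \<open>Translating a function and subtracting a constant preserve the set of its derivatives, and hence the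
value chosen by \<open>deriv\<close>, even at points where that set is empty.\<close>

lemma iterated_deriv_euler_term:
  "(deriv ^^ Suc j) (euler_term g k) = (\<lambda>x. (deriv ^^ Suc j) g (x + real k))"
proof (induction j)
  case 0
  have const: "((\<lambda>x. f x - c) has_real_derivative D) (at x) \<longleftrightarrow> (f has_real_derivative D) (at x)"
    for f :: "real \<Rightarrow> real" and c D x
    using DERIV_add [OF _ DERIV_const, of "\<lambda>x. f x - c" D x UNIV c]
      DERIV_diff [OF _ DERIV_const, of f D x UNIV c] by auto
  have "deriv (euler_term g k) = deriv (\<lambda>x. g (x + real k))"
    by (simp add: fun_eq_iff euler_term_def [abs_def] deriv_def const)
  then show ?case by (simp add: deriv_shift_real)
next
  case (Suc j)
  then show ?case using deriv_shift_real [of "(deriv ^^ Suc j) g" "real k"] by simp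
qed

lemma continuous_on_uniform_limit_Ioo:
  fixes f :: "nat \<Rightarrow> real \<Rightarrow> real"
  assumes "\<And>k. continuous_on {-1<..} (f k)"
    and "\<And>B. uniform_limit {-1<..<real B} (\<lambda>N x. \<Sum>k<N. f k x) F sequentially"
  shows "continuous_on {-1<..} F"
proof -
  have "continuous_on {-1<..<real B} F" for B
  proof (rule uniform_limit_theorem [OF always_eventually assms(2)])
    show "\<forall>N. continuous_on {-1<..<real B} (\<lambda>x. \<Sum>k<N. f k x)"
      by (auto intro!: continuous_on_sum continuous_on_subset [OF assms(1)])
  qed simp
  then have "continuous_on (\<Union>B. {-1<..<real B}) F"
    by (intro continuous_on_open_UN) auto
  moreover have "(\<Union>B. {-1<..<real B}) = {-1<..}"
    using reals_Archimedean2 by auto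
  ultimately show ?thesis by simp
qed

lemma sums_of_uniform_limit_Ioo:
  fixes f :: "nat \<Rightarrow> real \<Rightarrow> real"
  assumes "\<And>B. uniform_limit {-1<..<real B} (\<lambda>N x. \<Sum>k<N. f k x) F sequentially" and "x > -1"
  shows "(\<lambda>k. f k x) sums F x"
proof -
  obtain B where "x < real B" using reals_Archimedean2 by blast
  then show ?thesis
    using tendsto_uniform_limitI [OF assms(1), of x B] assms(2) by (simp add: sums_def)
qed

lemma continuous_on_euler_term:
  assumes "continuous_on {0<..} g"
  shows "continuous_on {-1<..} (euler_term g (Suc k))"
  unfolding euler_term_def
  by (intro continuous_intros continuous_on_compose2 [OF assms]) auto

lemma integral_euler_term: "integral {0..1} (euler_term g (Suc k)) = 0"
  if "continuous_on {0<..} g"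
proof -
  let ?m = "real (Suc k)"
  have "continuous_on {0..1} (\<lambda>x. g (x + ?m))"
    by (intro continuous_intros continuous_on_compose2 [OF that]) auto
  then have "integral {0..1} (\<lambda>x. g (x + ?m) - integral {?m..?m + 1} g)
      = integral {0..1} (\<lambda>x. g (x + ?m)) - integral {?m..?m + 1} g"
    by (subst Henstock_Kurzweil_Integration.integral_diff) (auto intro: integrable_continuous_interval)
  also have "integral {0..1} (\<lambda>x. g (x + ?m)) = integral {?m..?m + 1} g"
    using integral_shift_real_ivl [of ?m ?m "?m + 1" g] by simp
  finally show ?thesis by (simp add: euler_term_def [abs_def])
qed

section \<open>The principal sum and its asymptotic constant\<close>

definition euler_series_termwise_deriv :: "(real \<Rightarrow> real) \<Rightarrow> nat \<Rightarrow> real \<Rightarrow> real" where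
  "euler_series_termwise_deriv g j x = (\<Sum>k. (deriv ^^ j) (euler_term g (Suc k)) x)"

context
  fixes g :: "real \<Rightarrow> real"
  assumes g0: "g \<in> C_class 0 \<inter> D_class 0 \<inter> K_class 0"
begin

lemma g_continuous: "continuous_on {0<..} g"
  using C_class_continuous_on [of g 0 0] g0 by simp

lemma g_eventually_monotone: "eventually_monotone g"
  using K_class_top_derivative_eventually_monotone [of g 0] g0 by simp

lemma g_vanishes: "(g \<longlongrightarrow> 0) at_top"
  using eventually_monotone_tendsto_0_at_top [OF g_eventually_monotone] g0 by (simp add: D_class_def)

lemmas euler_uniform = uniform_limit_euler_series [OF g_continuous g_eventually_monotone g_vanishes]

lemmas euler_sums = sums_of_uniform_limit_Ioo [OF euler_uniform]

lemma euler_series_continuous: "continuous_on {-1<..} (euler_series g)"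
  by (rule continuous_on_uniform_limit_Ioo [OF continuous_on_euler_term [OF g_continuous] euler_uniform])

text \<open>Passing from \<open>x\<close> to \<open>x + 1\<close> shifts the values of \<open>g\<close> in the partial sums by one index: the first one is
lost, and the new last one tends to \<open>0\<close>.\<close>

lemma euler_series_plus_1:
  assumes "x > -1"
  shows "euler_series g (x + 1) = euler_series g x - g (x + 1)"
proof -
  have partial: "(\<Sum>k<N. euler_term g (Suc k) (x + 1))
      = (\<Sum>k<N. euler_term g (Suc k) x) + g (x + 1 + real N) - g (x + 1)" for N
  proof (induction N)
    case (Suc N)
    have cancel: "(a - c) - (b - c) = a - b" for a b c :: real by simp
    have "euler_term g (Suc N) (x + 1) - euler_term g (Suc N) x
        = g (x + 1 + real (Suc N)) - g (x + real (Suc N))"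
      unfolding euler_term_def by (rule cancel)
    moreover have "x + real (Suc N) = x + 1 + real N" by simp
    ultimately show ?case using Suc by (simp only: sum.lessThan_Suc)
  qed simp
  have "filterlim (\<lambda>N. x + 1 + real N) at_top sequentially"
    by (rule filterlim_tendsto_add_at_top [OF tendsto_const filterlim_real_sequentially])
  then have "(\<lambda>N. g (x + 1 + real N)) \<longlonglongrightarrow> 0"
    by (rule filterlim_compose [OF g_vanishes])
  moreover have "(\<lambda>N. \<Sum>k<N. euler_term g (Suc k) x) \<longlonglongrightarrow> euler_series g x"
    using euler_sums [OF assms] by (simp add: sums_def)
  ultimately have "(\<lambda>N. \<Sum>k<N. euler_term g (Suc k) (x + 1)) \<longlonglongrightarrow> euler_series g x + 0 - g (x + 1)"
    unfolding partial by (intro tendsto_intros)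
  moreover have "(\<lambda>N. \<Sum>k<N. euler_term g (Suc k) (x + 1)) \<longlonglongrightarrow> euler_series g (x + 1)"
    using euler_sums [of "x + 1"] assms by (simp add: sums_def)
  ultimately show ?thesis using LIMSEQ_unique by fastforce
qed

text \<open>The integrals cancel in the difference of the \<open>k\<close>-th terms of the series at \<open>0\<close> and at \<open>x\<close>, leaving the
summand \<open>g k - g (x + k)\<close> of the defining limit; the latter is taken with \<open>p = 0\<close>.\<close>

lemma principal_sum_eq:
  assumes "x > 0"
  shows "principal_sum g x = euler_series g 0 - g x - euler_series g x"
proof -
  have least: "(LEAST p. g \<in> D_class p \<inter> K_class p) = 0"
    using g0 by (intro Least_eq_0) auto
  have approx: "Sigma_approx 0 g (Suc N) x
      = - g x + ((\<Sum>k<N. euler_term g (Suc k) 0) - (\<Sum>k<N. euler_term g (Suc k) x))" for N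
  proof -
    have "(\<Sum>k=1..<Suc N. g (real k) - g (x + real k)) = (\<Sum>k<N. g (real (Suc k)) - g (x + real (Suc k)))"
      using sum.shift_bounds_Suc_ivl [of "\<lambda>k. g (real k) - g (x + real k)" 0 N]
      by (simp add: atLeast0LessThan)
    then show ?thesis
      by (simp add: Sigma_approx_def euler_term_def flip: sum_subtractf)
  qed
  have "(\<lambda>N. Sigma_approx 0 g (Suc N) x) \<longlonglongrightarrow> - g x + (euler_series g 0 - euler_series g x)"
    unfolding approx using euler_sums [of 0] euler_sums [of x] assms
    by (intro tendsto_intros) (simp_all add: sums_def)
  then have "(\<lambda>n. Sigma_approx 0 g n x) \<longlonglongrightarrow> - g x + (euler_series g 0 - euler_series g x)"
    by (rule LIMSEQ_imp_Suc)
  then show ?thesis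
    unfolding principal_sum_def least by (simp add: limI)
qed

lemma integral_euler_series: "integral {0..1} (euler_series g) = 0"
proof -
  have u: "uniform_limit {0..1} (\<lambda>N x. \<Sum>k<N. euler_term g (Suc k) x) (euler_series g) sequentially"
    using euler_uniform [of 2] by (rule uniform_limit_on_subset) auto
  have cont: "continuous_on {0..1} (euler_term g (Suc k))" for k
    using continuous_on_euler_term [OF g_continuous] by (rule continuous_on_subset) auto
  obtain I J where IJ: "\<And>N. ((\<lambda>x. \<Sum>k<N. euler_term g (Suc k) x) has_integral I N) {0..1}"
      "(euler_series g has_integral J) {0..1}" "I \<longlonglongrightarrow> J"
    by (rule uniform_limit_integral [OF u]) (auto intro!: continuous_on_sum cont)
  have zero: "I N = 0" for N
  proof -
    have "I N = integral {0..1} (\<lambda>x. \<Sum>k<N. euler_term g (Suc k) x)"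
      using IJ(1) by (rule integral_unique [symmetric])
    also have "\<dots> = (\<Sum>k<N. integral {0..1} (euler_term g (Suc k)))"
      by (intro integral_sum integrable_continuous_interval cont) auto
    finally show ?thesis by (simp add: integral_euler_term g_continuous)
  qed
  have "I \<longlonglongrightarrow> 0" unfolding zero [abs_def] by (rule tendsto_const)
  then have "J = 0" using IJ(3) LIMSEQ_unique by blast
  then show ?thesis using IJ(2) by (simp add: integral_unique)
qed

text \<open>By the shift relation \<open>\<Sigma>g (t + 1)\<close> is \<open>E (0) - E (t)\<close>, and the integral of \<open>E\<close> over \<open>[0, 1]\<close> is \<open>0\<close>.\<close>

lemma asymptotic_const_eq: "asymptotic_const g = euler_series g 0"
proof -
  have "asymptotic_const g = integral {0..1} (\<lambda>t. euler_series g 0 - euler_series g t)"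
    unfolding asymptotic_const_def
    by (rule Henstock_Kurzweil_Integration.integral_cong) (simp add: principal_sum_eq euler_series_plus_1)
  also have "\<dots> = euler_series g 0 - integral {0..1} (euler_series g)"
    by (subst Henstock_Kurzweil_Integration.integral_diff)
      (auto intro!: integrable_continuous_interval continuous_on_subset [OF euler_series_continuous])
  finally show ?thesis by (simp add: integral_euler_series)
qed

text \<open>The degree is \<open>-1\<close>, so the operator has order \<open>1\<close> and its only Gregory summand is a multiple of
\<open>\<Sigma>g (1) = 0\<close>.\<close>

lemma gen_euler_const_eq: "gen_euler_const g = asymptotic_const g"
proof -
  have "(LEAST q. ((fdiff ^^ q) g \<longlongrightarrow> 0) at_top) = 0"
    using g_vanishes by (intro Least_eq_0) simp
  then have deg: "asymptotic_deg g = - 1" by (simp add: asymptotic_deg_def)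
  have at_1: "principal_sum g 1 = 0"
    using principal_sum_eq [of 1] euler_series_plus_1 [of 0] by simp
  have "integral {1..1 + 1} (principal_sum g) = asymptotic_const g"
    using integral_shift_real_ivl [of 1 1 "1 + 1" "principal_sum g"]
    by (simp add: asymptotic_const_def)
  then show ?thesis by (simp add: gen_euler_const_def deg J_op_def at_1)
qed

text \<open>The undifferentiated series and the series of order \<open>j \<ge> 1\<close> converge for different reasons: in the
former the integrals compensate for \<open>g\<close>, which need not be summable, whereas the derivatives are summable by
themselves.\<close>

lemma derivative_series:
  assumes r: "g \<in> C_class r \<inter> K_class r"
  shows derivative_series_uniform: "j \<le> r \<Longrightarrow> uniform_limit {-1<..<real B}
      (\<lambda>N x. \<Sum>k<N. (deriv ^^ j) (euler_term g (Suc k)) x) (euler_series_termwise_deriv g j) sequentially"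
    and derivative_series_has_derivative: "j < r \<Longrightarrow> x > -1 \<Longrightarrow>
      (euler_series_termwise_deriv g j has_real_derivative euler_series_termwise_deriv g (Suc j) x) (at x)"
    and derivative_series_continuous: "j \<le> r \<Longrightarrow> continuous_on {-1<..} (euler_series_termwise_deriv g j)"
proof -
  have d: "((deriv ^^ j) g has_real_derivative (deriv ^^ Suc j) g y) (at y)" if "j < r" "y > 0" for j y
    using C_class_has_derivative r that by blast
  have van: "eventually_monotone ((deriv ^^ j) g) \<and> ((deriv ^^ j) g \<longlongrightarrow> 0) at_top" if "j \<le> r" for j
    using derivatives_eventually_monotone_vanishing [of r "\<lambda>j. (deriv ^^ j) g"] d
      K_class_top_derivative_eventually_monotone [of g r] r g_vanishes that by auto
  have unif: "uniform_limit {-1<..<real B}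
      (\<lambda>N x. \<Sum>k<N. (deriv ^^ j) (euler_term g (Suc k)) x) (euler_series_termwise_deriv g j) sequentially" if "j \<le> r" for j B
  proof (cases j)
    case 0
    then have "euler_series_termwise_deriv g j = euler_series g" by (simp add: euler_series_termwise_deriv_def euler_series_def fun_eq_iff)
    then show ?thesis using euler_uniform [of B] 0 by simp
  next
    case (Suc i)
    then have "uniform_limit {-1<..<real B} (\<lambda>N x. \<Sum>k<N. (deriv ^^ Suc i) g (x + real (Suc k)))
        (\<lambda>x. \<Sum>k. (deriv ^^ Suc i) g (x + real (Suc k))) sequentially"
      using that van [of i] van [of "Suc i"] d [of i]
      by (intro uniform_limit_derivative_series [of "(deriv ^^ i) g"]) simp_all
    then show ?thesis
      unfolding euler_series_termwise_deriv_def [abs_def] Suc iterated_deriv_euler_term .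
  qed
  show "j \<le> r \<Longrightarrow> uniform_limit {-1<..<real B}
      (\<lambda>N x. \<Sum>k<N. (deriv ^^ j) (euler_term g (Suc k)) x) (euler_series_termwise_deriv g j) sequentially" for j B
    by (rule unif)
  have td: "((deriv ^^ j) (euler_term g (Suc k)) has_real_derivative
      (deriv ^^ Suc j) (euler_term g (Suc k)) x) (at x)" if "j < r" "x > -1" for j k x
  proof -
    have *: "((\<lambda>x. (deriv ^^ j) g (x + real (Suc k))) has_real_derivative
        (deriv ^^ Suc j) g (x + real (Suc k))) (at x)"
      using d [of j "x + real (Suc k)"] that by (subst DERIV_shift [symmetric]) auto
    show ?thesis
    proof (cases j)
      case 0
      have "((\<lambda>x. g (x + real (Suc k)) - integral {real (Suc k)..real (Suc k) + 1} g)
          has_real_derivative deriv g (x + real (Suc k)) - 0) (at x)"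
        using * unfolding 0 by (intro DERIV_diff DERIV_const) simp
      then show ?thesis
        using iterated_deriv_euler_term [of 0 g "Suc k"] unfolding 0
        by (simp add: euler_term_def [abs_def])
    next
      case (Suc i)
      show ?thesis using * unfolding Suc iterated_deriv_euler_term .
    qed
  qed
  show "(euler_series_termwise_deriv g j has_real_derivative euler_series_termwise_deriv g (Suc j) x) (at x)" if "j < r" "x > -1" for j x
  proof -
    obtain B where B: "max 0 x < real B" using reals_Archimedean2 by blast
    show ?thesis
      unfolding euler_series_termwise_deriv_def [abs_def]
    proof (rule has_field_derivative_series'(2) [where S = "{-1<..<real B}" and ?x0.0 = 0])
      show "uniformly_convergent_on {-1<..<real B}
          (\<lambda>n x. \<Sum>k<n. (deriv ^^ Suc j) (euler_term g (Suc k)) x)"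
        using unif [of "Suc j" B] that by (auto simp: uniformly_convergent_on_def)
      show "((deriv ^^ j) (euler_term g (Suc n)) has_real_derivative
          (deriv ^^ Suc j) (euler_term g (Suc n)) y) (at y within {-1<..<real B})"
        if "y \<in> {-1<..<real B}" for n y
        by (rule has_field_derivative_at_within [OF td [OF \<open>j < r\<close>]]) (use that in simp)
      show "summable (\<lambda>k. (deriv ^^ j) (euler_term g (Suc k)) 0)"
        using sums_of_uniform_limit_Ioo [OF unif, of j 0] that by (auto simp: sums_iff)
      show "x \<in> interior {-1<..<real B}" using B that by (simp add: interior_open)
    qed (use B in auto)
  qed
  show "continuous_on {-1<..} (euler_series_termwise_deriv g j)" if "j \<le> r" for j
  proof (rule continuous_on_uniform_limit_Ioo [OF _ unif [OF that]])
    show "continuous_on {-1<..} ((deriv ^^ j) (euler_term g (Suc k)))" for k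
    proof (cases j)
      case 0
      then show ?thesis using continuous_on_euler_term [OF g_continuous] by simp
    next
      case (Suc i)
      show ?thesis
        unfolding Suc iterated_deriv_euler_term
        by (intro continuous_on_compose2 [OF C_class_continuous_on [of g r "Suc i"]] continuous_intros)
          (use r that Suc in auto)
    qed
  qed
qed

end

theorem theorem8p5:
  fixes g :: "real \<Rightarrow> real"
  assumes "g \<in> C_class 0 \<inter> D_class 0 \<inter> K_class 0"
  shows
    "gen_euler_const g = asymptotic_const g
     \<and>
     (\<forall>x>0. summable (\<lambda>k. euler_term g (Suc k) x)
        \<and> principal_sum g x = asymptotic_const g - g x - euler_series g x)
     \<and>
     (\<forall>B. bounded B \<and> B \<subseteq> {0..} \<longrightarrow>
        uniform_limit B (\<lambda>N x. \<Sum>k<N. euler_term g (Suc k) x) (euler_series g) sequentially)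
     \<and>
     principal_sum g \<in> C_class 0
     \<and>
     (\<forall>a m x. (\<forall>i. 0 \<le> a i) \<and> 0 \<le> x \<longrightarrow>
        (\<forall>k. interval_lebesgue_integrable lborel (ereal (a m)) (ereal x)
               (iter_integral a m (euler_term g (Suc k))))
        \<and> interval_lebesgue_integrable lborel (ereal (a m)) (ereal x)
            (iter_integral a m (euler_series g))
        \<and> (\<lambda>k. iter_integral a (Suc m) (euler_term g (Suc k)) x)
            sums iter_integral a (Suc m) (euler_series g) x)
     \<and>
     (\<forall>r. g \<in> C_class r \<inter> K_class r \<longrightarrow>
        principal_sum g \<in> C_class r
        \<and> (\<forall>j<r. \<forall>x\<ge>0. (deriv ^^ j) (euler_series g) differentiable (at x))
        \<and> (\<forall>j\<le>r. \<forall>x\<ge>0. (\<lambda>k. (deriv ^^ j) (euler_term g (Suc k)) x)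
              sums (deriv ^^ j) (euler_series g) x))"
proof -
  note g0 = assms
  have unif: "uniform_limit B (\<lambda>N x. \<Sum>k<N. euler_term g (Suc k) x) (euler_series g) sequentially"
    if "bounded B" "B \<subseteq> {0..}" for B
  proof -
    obtain b where b: "\<And>x. x \<in> B \<Longrightarrow> \<bar>x\<bar> \<le> b" using \<open>bounded B\<close> by (auto simp: bounded_iff)
    obtain n where "b < real n" using reals_Archimedean2 by blast
    then show ?thesis
      by (intro uniform_limit_on_subset [OF euler_uniform [OF g0, of n]]) (use b that in force)
  qed
  have smooth: "principal_sum g \<in> C_class r
      \<and> (\<forall>j<r. \<forall>x\<ge>0. (deriv ^^ j) (euler_series g) differentiable (at x))
      \<and> (\<forall>j\<le>r. \<forall>x\<ge>0. (\<lambda>k. (deriv ^^ j) (euler_term g (Suc k)) x)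
            sums (deriv ^^ j) (euler_series g) x)"
    if r: "g \<in> C_class r \<inter> K_class r" for r
  proof -
    let ?E = "euler_series_termwise_deriv g"
    note E_uniform = derivative_series_uniform [OF g0 r]
    note E_deriv = derivative_series_has_derivative [OF g0 r]
    note E_cont = derivative_series_continuous [OF g0 r]
    have E0: "euler_series g x = ?E 0 x" for x by (simp add: euler_series_termwise_deriv_def euler_series_def)
    have E_eq: "(deriv ^^ j) (euler_series g) x = ?E j x" if "j \<le> r" "x > -1" for j x
      using iterated_deriv_eq [of "{-1<..}" "euler_series g" ?E r j x] E0 E_deriv that by auto
    have "(deriv ^^ j) (euler_series g) differentiable (at x)" if "j < r" "x \<ge> 0" for j x
      using iterated_deriv_has_derivative [of "{-1<..}" "euler_series g" ?E r j x] E0 E_deriv that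
      by (auto simp: real_differentiable_def)
    moreover have "(\<lambda>k. (deriv ^^ j) (euler_term g (Suc k)) x) sums (deriv ^^ j) (euler_series g) x"
      if "j \<le> r" "x \<ge> 0" for j x
      using sums_of_uniform_limit_Ioo [OF E_uniform, of j x] that E_eq by simp
    moreover have "principal_sum g \<in> C_class r"
    proof (rule C_classI [where F = "\<lambda>j x. (if j = 0 then euler_series g 0 else 0) - (deriv ^^ j) g x - ?E j x"])
      show "principal_sum g x = (if (0::nat) = 0 then euler_series g 0 else 0) - (deriv ^^ 0) g x - ?E 0 x"
        if "x > 0" for x
        using principal_sum_eq [OF g0 that] by (simp add: E0)
      show "((\<lambda>x. (if j = 0 then euler_series g 0 else 0) - (deriv ^^ j) g x - ?E j x) has_real_derivative
          (if Suc j = 0 then euler_series g 0 else 0) - (deriv ^^ Suc j) g x - ?E (Suc j) x) (at x)"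
        if "j < r" "x > 0" for j x
        using C_class_has_derivative [of g r j x] E_deriv [of j x] r that
          DERIV_diff [OF DERIV_diff [OF DERIV_const]] by fastforce
      show "continuous_on {0<..} (\<lambda>x. (if j = 0 then euler_series g 0 else 0) - (deriv ^^ j) g x - ?E j x)"
        if "j \<le> r" for j
        using C_class_continuous_on [of g r j] r that
        by (intro continuous_on_diff continuous_on_const continuous_on_subset [OF E_cont [OF that]]) auto
    qed
    ultimately show ?thesis by blast
  qed
  have cont: "continuous_on {0..} (euler_term g (Suc k))" for k
    using continuous_on_euler_term [OF g_continuous [OF g0]] by (rule continuous_on_subset) auto
  have "summable (\<lambda>k. euler_term g (Suc k) x)" if "x > 0" for x
    using euler_sums [OF g0, of x] that by (auto simp: sums_iff)
  moreover have "principal_sum g x = asymptotic_const g - g x - euler_series g x" if "x > 0" for x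
    using principal_sum_eq [OF g0 that] asymptotic_const_eq [OF g0] by simp
  moreover have "principal_sum g \<in> C_class 0"
    using smooth [of 0] g0 by blast
  moreover have "(\<forall>k. interval_lebesgue_integrable lborel (ereal (a m)) (ereal x)
               (iter_integral a m (euler_term g (Suc k))))
        \<and> interval_lebesgue_integrable lborel (ereal (a m)) (ereal x)
            (iter_integral a m (euler_series g))
        \<and> (\<lambda>k. iter_integral a (Suc m) (euler_term g (Suc k)) x)
            sums iter_integral a (Suc m) (euler_series g) x"
    if "\<forall>i. 0 \<le> a i" "0 \<le> x" for a m x
    using series_iter_integral [of "\<lambda>k. euler_term g (Suc k)" "euler_series g" a x, OF cont unif] that
    by (simp del: iter_integral.simps)
  ultimately show ?thesis
    using gen_euler_const_eq [OF g0] unif smooth by (intro conjI) blast+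
qed

end
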